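(* Let $(A,\mu,\alpha)$ be a Hom-associative algebra and $r\in A^{\otimes 2}$ be a solution of the associative Hom-Yang-Baxter equation (AHYBE) in $A$. Suppose that $r$ is either symmetric or anti-symmetric. Then $r$ is a solution of the classical Hom-Yang-Baxter equation (CHYBE) in the Hom-Lie algebra $A_{HLie}=(A,[-,-]=\mu\circ(Id-\tau),\alpha)$.
   Context: Throughout, $\mathbf{k}$ is a fixed field of characteristic $0$; vector spaces, linear maps and tensor products are over $\mathbf{k}$. $\tau$ denotes the twist $\tau(x\otimes y)=y\otimes x$. A $2$-tensor $r$ is symmetric if $\tau(r)=r$ and anti-symmetric if $\tau(r)=-r$. A Hom-associative algebra $(A,\mu,\alpha)$ is a $\mathbf{k}$-vector space $A$ with a bilinear map $\mu\colon A^{\otimes 2}\to A$ and a linear map $\alpha\colon A\to A$ such that $\alpha\circ\mu=\mu\circ\alpha^{\otimes 2}$ and $\mu\circ(\alpha\otimes\mu)=\mu\circ(\mu\otimes\alpha)$. For $r=\sum u_i\otimes v_i\in A^{\otimes 2}$ set $$A(r)=\sum_{i,j}\mu(u_i,u_j)\otimes\alpha(v_j)\otimes\alpha(v_i)-\sum_{i,j}\alpha(u_i)\otimes\mu(v_i,u_j)\otimes\alpha(v_j)+\sum_{i,j}\alpha(u_j)\otimes\alpha(u_i)\otimes\mu(v_i,v_j)\in A^{\otimes 3}.$$ The element $r$ is a solution of the AHYBE in $A$ if $A(r)=0$. A Hom-Lie algebra $(L,[-,-],\alpha)$ is a vector space $L$ with a linear map $\alpha\colon L\to L$ and an anti-symmetric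 bilinear bracket such that $\alpha\circ[-,-]=[-,-]\circ\alpha^{\otimes 2}$ and $[[x,y],\alpha(z)]+[[z,x],\alpha(y)]+[[y,z],\alpha(x)]=0$ for all $x,y,z\in L$. If $(A,\mu,\alpha)$ is a Hom-associative algebra, then $(A,\mu\circ(Id-\tau),\alpha)$ is a Hom-Lie algebra. For $r=\sum u_i\otimes v_i\in L^{\otimes 2}$ set $$C(r)=\sum_{i,j}[u_i,u_j]\otimes\alpha(v_i)\otimes\alpha(v_j)+\sum_{i,j}\alpha(u_i)\otimes[v_i,u_j]\otimes\alpha(v_j)+\sum_{i,j}\alpha(u_i)\otimes\alpha(u_j)\otimes[v_i,v_j]\in L^{\otimes 3}.$$ The element $r$ is a solution of the CHYBE in $L$ if $C(r)=0$. *)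

theory Defs
  imports Complex_Main "HOL-Library.Poly_Mapping"
begin

section \<open>Free vector spaces and their quotients\<close>

text \<open>
  The library has no algebraic tensor product of vector spaces over an arbitrary field. Tensor
  squares and cubes are therefore constructed as usual: as quotients of the free vector space
  (finitely supported functions) on \<open>A \<times> A\<close>, respectively \<open>A \<times> A \<times> A\<close>, by the subspace
  spanned by the multilinearity relations. A tensor is a coset of that subspace, hence a set of formal
  linear combinations.
\<close>

definition fscale :: "'k::field \<Rightarrow> ('b \<Rightarrow>\<^sub>0 'k) \<Rightarrow> ('b \<Rightarrow>\<^sub>0 'k)" where
  "fscale c = Poly_Mapping.map ((*) c)"

lemma lookup_fscale [simp]: "Poly_Mapping.lookup (fscale c f) x = c * Poly_Mapping.lookup f x"
  unfolding fscale_def by transfer (simp add: when_def)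

global_interpretation free: vector_space fscale
  by standard (auto intro!: poly_mapping_eqI simp: lookup_add algebra_simps)

abbreviation pure :: "'b \<Rightarrow> ('b \<Rightarrow>\<^sub>0 'k::field)" where
  "pure b \<equiv> Poly_Mapping.single b 1"

definition coset :: "('b \<Rightarrow>\<^sub>0 'k::field) set \<Rightarrow> ('b \<Rightarrow>\<^sub>0 'k) \<Rightarrow> ('b \<Rightarrow>\<^sub>0 'k) set" where
  "coset N f = {g. g - f \<in> N}"

text \<open>
  The relations saying that \<open>\<phi>\<close>, the inclusion of one argument slot (all other slots being held
  fixed), is linear.
\<close>

definition slot_relators ::
    "('k::field \<Rightarrow> 'a::ab_group_add \<Rightarrow> 'a) \<Rightarrow> ('a \<Rightarrow> 'b) \<Rightarrow> ('b \<Rightarrow>\<^sub>0 'k) set" where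
  "slot_relators s \<phi> =
     {pure (\<phi> (x + y)) - pure (\<phi> x) - pure (\<phi> y) | x y. True} \<union>
     {pure (\<phi> (s c x)) - fscale c (pure (\<phi> x)) | c x. True}"


section \<open>Tensor squares and tensor cubes\<close>

definition relations2 ::
    "('k::field \<Rightarrow> 'a::ab_group_add \<Rightarrow> 'a) \<Rightarrow> ('a \<times> 'a \<Rightarrow>\<^sub>0 'k) set" where
  "relations2 s = free.span
     ((\<Union>y. slot_relators s (\<lambda>x. (x, y))) \<union> (\<Union>x. slot_relators s (\<lambda>y. (x, y))))"

definition relations3 ::
    "('k::field \<Rightarrow> 'a::ab_group_add \<Rightarrow> 'a) \<Rightarrow> ('a \<times> 'a \<times> 'a \<Rightarrow>\<^sub>0 'k) set" where
  "relations3 s = free.span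
     ((\<Union>y z. slot_relators s (\<lambda>x. (x, y, z))) \<union>
      (\<Union>x z. slot_relators s (\<lambda>y. (x, y, z))) \<union>
      (\<Union>x y. slot_relators s (\<lambda>z. (x, y, z))))"

definition tensor_square ::
    "('k::field \<Rightarrow> 'a::ab_group_add \<Rightarrow> 'a) \<Rightarrow> ('a \<times> 'a \<Rightarrow>\<^sub>0 'k) set set" where
  "tensor_square s = range (coset (relations2 s))"

definition zero_cube ::
    "('k::field \<Rightarrow> 'a::ab_group_add \<Rightarrow> 'a) \<Rightarrow> ('a \<times> 'a \<times> 'a \<Rightarrow>\<^sub>0 'k) set" where
  "zero_cube s = coset (relations3 s) 0"

text \<open>The element \<open>\<Sum>i<n. u i \<otimes> v i\<close> of the tensor square.\<close>

definition tensor_sum ::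
    "('k::field \<Rightarrow> 'a::ab_group_add \<Rightarrow> 'a) \<Rightarrow> nat \<Rightarrow> (nat \<Rightarrow> 'a) \<Rightarrow> (nat \<Rightarrow> 'a)
      \<Rightarrow> ('a \<times> 'a \<Rightarrow>\<^sub>0 'k) set" where
  "tensor_sum s n u v = coset (relations2 s) (\<Sum>i<n. pure (u i, v i))"

text \<open>
  Operations on cosets are taken elementwise. In \<open>twist\<close>, \<open>map_key\<close> is precomposition, and
  \<open>prod.swap\<close> is its own inverse, so \<open>pure (x, y)\<close> is sent to \<open>pure (y, x)\<close>.
\<close>

definition twist :: "('a \<times> 'a \<Rightarrow>\<^sub>0 'k::field) set \<Rightarrow> ('a \<times> 'a \<Rightarrow>\<^sub>0 'k) set" where
  "twist r = Poly_Mapping.map_key prod.swap ` r"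

definition symmetric_tensor :: "('a \<times> 'a \<Rightarrow>\<^sub>0 'k::field) set \<Rightarrow> bool" where
  "symmetric_tensor r \<longleftrightarrow> twist r = r"

definition antisymmetric_tensor :: "('a \<times> 'a \<Rightarrow>\<^sub>0 'k::field) set \<Rightarrow> bool" where
  "antisymmetric_tensor r \<longleftrightarrow> twist r = uminus ` r"


section \<open>Hom-associative and Hom-Lie algebras\<close>

definition bilinear_map ::
    "('k::field \<Rightarrow> 'a::ab_group_add \<Rightarrow> 'a) \<Rightarrow> ('a \<Rightarrow> 'a \<Rightarrow> 'a) \<Rightarrow> bool" where
  "bilinear_map s m \<longleftrightarrow>
     (\<forall>x. Vector_Spaces.linear s s (m x)) \<and> (\<forall>y. Vector_Spaces.linear s s (\<lambda>x. m x y))"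

locale hom_associative_algebra = vector_space scale
  for scale :: "'k::field \<Rightarrow> 'a::ab_group_add \<Rightarrow> 'a" +
  fixes mu :: "'a \<Rightarrow> 'a \<Rightarrow> 'a" and alpha :: "'a \<Rightarrow> 'a"
  assumes mu_bilinear: "bilinear_map scale mu"
    and alpha_linear: "Vector_Spaces.linear scale scale alpha"
    and alpha_mu: "alpha (mu x y) = mu (alpha x) (alpha y)"
    and hom_assoc: "mu (alpha x) (mu y z) = mu (mu x y) (alpha z)"

locale hom_lie_algebra = vector_space scale
  for scale :: "'k::field \<Rightarrow> 'a::ab_group_add \<Rightarrow> 'a" +
  fixes bracket :: "'a \<Rightarrow> 'a \<Rightarrow> 'a" and alpha :: "'a \<Rightarrow> 'a"
  assumes bracket_bilinear: "bilinear_map scale bracket"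
    and alpha_linear: "Vector_Spaces.linear scale scale alpha"
    and bracket_antisym: "bracket x y = - bracket y x"
    and alpha_bracket: "alpha (bracket x y) = bracket (alpha x) (alpha y)"
    and hom_jacobi: "bracket (bracket x y) (alpha z) + bracket (bracket z x) (alpha y)
                       + bracket (bracket y z) (alpha x) = 0"

definition commutator :: "('a \<Rightarrow> 'a \<Rightarrow> 'a::ab_group_add) \<Rightarrow> 'a \<Rightarrow> 'a \<Rightarrow> 'a" where
  "commutator mu x y = mu x y - mu y x"

lemma bilinear_map_iff:
  "bilinear_map s m \<longleftrightarrow> vector_space s \<and>
     (\<forall>x y z. m x (y + z) = m x y + m x z) \<and> (\<forall>c x y. m x (s c y) = s c (m x y)) \<and>
     (\<forall>x y z. m (x + y) z = m x z + m y z) \<and> (\<forall>c x y. m (s c x) y = s c (m x y))"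
  unfolding bilinear_map_def Vector_Spaces.linear_iff by blast

lemma bilinear_map_commutator:
  assumes "bilinear_map s m" shows "bilinear_map s (commutator m)"
proof -
  interpret vector_space s using assms by (simp add: bilinear_map_iff)
  show ?thesis using assms
    by (simp add: bilinear_map_iff commutator_def scale_right_diff_distrib)
qed

lemma (in hom_associative_algebra) hom_lie_commutator:
  "hom_lie_algebra scale (commutator mu) alpha"
proof -
  have 1: "mu x (y - z) = mu x y - mu x z" "mu (x - y) z = mu x z - mu y z"
    "alpha (x - y) = alpha x - alpha y" for x y z
    using mu_bilinear alpha_linear
    unfolding bilinear_map_iff Vector_Spaces.linear_iff by (metis add_diff_cancel eq_diff_eq)+
  show ?thesis
    by (intro hom_lie_algebra.intro hom_lie_algebra_axioms.intro vector_space_axioms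
          bilinear_map_commutator mu_bilinear alpha_linear)
      (simp_all add: commutator_def 1 alpha_mu hom_assoc)
qed


section \<open>The associative and the classical Hom-Yang-Baxter equation\<close>

text \<open>
  First the two expressions for a given presentation \<open>\<Sum>i<n. u i \<otimes> v i\<close>, as formal linear
  combinations; then the induced maps \<open>r \<mapsto> A(r)\<close> and \<open>r \<mapsto> C(r)\<close> from the tensor square to the
  tensor cube. The value does not depend on the presentation, and every tensor has one, so the
  descriptions are definite: see \<open>assoc_yb_tensor_sum\<close>, \<open>classical_yb_tensor_sum\<close> and
  \<open>tensor_square_eq_tensor_sum\<close> below.
\<close>

definition assoc_yb_rep ::
    "('a \<Rightarrow> 'a \<Rightarrow> 'a) \<Rightarrow> ('a \<Rightarrow> 'a) \<Rightarrow> nat \<Rightarrow> (nat \<Rightarrow> 'a) \<Rightarrow> (nat \<Rightarrow> 'a)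
      \<Rightarrow> ('a \<times> 'a \<times> 'a \<Rightarrow>\<^sub>0 'k::field)" where
  "assoc_yb_rep mu alpha n u v =
     (\<Sum>i<n. \<Sum>j<n. pure (mu (u i) (u j), alpha (v j), alpha (v i)))
     - (\<Sum>i<n. \<Sum>j<n. pure (alpha (u i), mu (v i) (u j), alpha (v j)))
     + (\<Sum>i<n. \<Sum>j<n. pure (alpha (u j), alpha (u i), mu (v i) (v j)))"

definition classical_yb_rep ::
    "('a \<Rightarrow> 'a \<Rightarrow> 'a) \<Rightarrow> ('a \<Rightarrow> 'a) \<Rightarrow> nat \<Rightarrow> (nat \<Rightarrow> 'a) \<Rightarrow> (nat \<Rightarrow> 'a)
      \<Rightarrow> ('a \<times> 'a \<times> 'a \<Rightarrow>\<^sub>0 'k::field)" where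
  "classical_yb_rep bracket alpha n u v =
     (\<Sum>i<n. \<Sum>j<n. pure (bracket (u i) (u j), alpha (v i), alpha (v j)))
     + (\<Sum>i<n. \<Sum>j<n. pure (alpha (u i), bracket (v i) (u j), alpha (v j)))
     + (\<Sum>i<n. \<Sum>j<n. pure (alpha (u i), alpha (u j), bracket (v i) (v j)))"

definition assoc_yb ::
    "('k::field \<Rightarrow> 'a::ab_group_add \<Rightarrow> 'a) \<Rightarrow> ('a \<Rightarrow> 'a \<Rightarrow> 'a) \<Rightarrow> ('a \<Rightarrow> 'a)
      \<Rightarrow> ('a \<times> 'a \<Rightarrow>\<^sub>0 'k) set \<Rightarrow> ('a \<times> 'a \<times> 'a \<Rightarrow>\<^sub>0 'k) set" where
  "assoc_yb s mu alpha r = (THE t. \<exists>n u v. r = tensor_sum s n u v \<and>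
     t = coset (relations3 s) (assoc_yb_rep mu alpha n u v))"

definition classical_yb ::
    "('k::field \<Rightarrow> 'a::ab_group_add \<Rightarrow> 'a) \<Rightarrow> ('a \<Rightarrow> 'a \<Rightarrow> 'a) \<Rightarrow> ('a \<Rightarrow> 'a)
      \<Rightarrow> ('a \<times> 'a \<Rightarrow>\<^sub>0 'k) set \<Rightarrow> ('a \<times> 'a \<times> 'a \<Rightarrow>\<^sub>0 'k) set" where
  "classical_yb s bracket alpha r = (THE t. \<exists>n u v. r = tensor_sum s n u v \<and>
     t = coset (relations3 s) (classical_yb_rep bracket alpha n u v))"

definition AHYBE_solution ::
    "('k::field \<Rightarrow> 'a::ab_group_add \<Rightarrow> 'a) \<Rightarrow> ('a \<Rightarrow> 'a \<Rightarrow> 'a) \<Rightarrow> ('a \<Rightarrow> 'a)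
      \<Rightarrow> ('a \<times> 'a \<Rightarrow>\<^sub>0 'k) set \<Rightarrow> bool" where
  "AHYBE_solution s mu alpha r \<longleftrightarrow> r \<in> tensor_square s \<and> assoc_yb s mu alpha r = zero_cube s"

definition CHYBE_solution ::
    "('k::field \<Rightarrow> 'a::ab_group_add \<Rightarrow> 'a) \<Rightarrow> ('a \<Rightarrow> 'a \<Rightarrow> 'a) \<Rightarrow> ('a \<Rightarrow> 'a)
      \<Rightarrow> ('a \<times> 'a \<Rightarrow>\<^sub>0 'k) set \<Rightarrow> bool" where
  "CHYBE_solution s bracket alpha r \<longleftrightarrow>
     r \<in> tensor_square s \<and> classical_yb s bracket alpha r = zero_cube s"


section \<open>Independence of the presentation\<close>

lemma coset_eq_iff:
  assumes "free.subspace N"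
  shows "coset N f = coset N g \<longleftrightarrow> f - g \<in> N"
proof
  assume "coset N f = coset N g"
  moreover have "f \<in> coset N f" using assms by (simp add: coset_def free.subspace_0)
  ultimately show "f - g \<in> N" by (simp add: coset_def)
next
  assume *: "f - g \<in> N"
  have "h - f \<in> N \<longleftrightarrow> h - g \<in> N" for h
    using free.subspace_add[OF assms, of "h - f" "f - g"]
      free.subspace_diff[OF assms, of "h - g" "f - g"] * by auto
  then show "coset N f = coset N g" by (simp add: coset_def)
qed

lemma subspace_relations [simp]:
  "free.subspace (relations2 s)" "free.subspace (relations3 s)"
  by (simp_all add: relations2_def relations3_def)

definition linear_mod ::
    "('k::field \<Rightarrow> 'a::ab_group_add \<Rightarrow> 'a) \<Rightarrow> ('b \<Rightarrow>\<^sub>0 'k) set \<Rightarrow> ('a \<Rightarrow> ('b \<Rightarrow>\<^sub>0 'k)) \<Rightarrow> bool" where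
  "linear_mod s N h \<longleftrightarrow>
     (\<forall>x y. h (x + y) - h x - h y \<in> N) \<and> (\<forall>c x. h (s c x) - fscale c (h x) \<in> N)"

lemma linear_mod_add:
  assumes N: "free.subspace N" and "linear_mod s N g" "linear_mod s N h"
  shows "linear_mod s N (\<lambda>x. g x + h x)"
  unfolding linear_mod_def
proof (intro conjI allI)
  fix x y c
  have "(g (x + y) - g x - g y) + (h (x + y) - h x - h y) \<in> N"
    using assms by (intro free.subspace_add) (auto simp: linear_mod_def)
  then show "g (x + y) + h (x + y) - (g x + h x) - (g y + h y) \<in> N"
    by (simp add: algebra_simps)
  have "(g (s c x) - fscale c (g x)) + (h (s c x) - fscale c (h x)) \<in> N"
    using assms by (intro free.subspace_add) (auto simp: linear_mod_def)
  then show "g (s c x) + h (s c x) - fscale c (g x + h x) \<in> N"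
    by (simp add: algebra_simps)
qed

lemma linear_mod_scale:
  assumes N: "free.subspace N" and "linear_mod s N h"
  shows "linear_mod s N (\<lambda>x. fscale a (h x))"
  unfolding linear_mod_def
proof (intro conjI allI)
  fix x y c
  have "fscale a (h (x + y) - h x - h y) \<in> N"
    using assms by (intro free.subspace_scale) (auto simp: linear_mod_def)
  then show "fscale a (h (x + y)) - fscale a (h x) - fscale a (h y) \<in> N"
    by (simp add: free.scale_right_diff_distrib)
  have "fscale a (h (s c x) - fscale c (h x)) \<in> N"
    using assms by (intro free.subspace_scale) (auto simp: linear_mod_def)
  then show "fscale a (h (s c x)) - fscale c (fscale a (h x)) \<in> N"
    by (simp add: free.scale_right_diff_distrib mult.commute)
qed

lemma linear_mod_diff:
  assumes "free.subspace N" "linear_mod s N g" "linear_mod s N h"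
  shows "linear_mod s N (\<lambda>x. g x - h x)"
  using linear_mod_add[OF assms(1,2) linear_mod_scale[OF assms(1,3), of "-1"]] by simp

lemma linear_mod_sum:
  assumes "free.subspace N" "\<And>i. i \<in> I \<Longrightarrow> linear_mod s N (h i)"
  shows "linear_mod s N (\<lambda>x. \<Sum>i\<in>I. h i x)"
  using assms(2)
  by (induction I rule: infinite_finite_induct)
    (use assms(1) in \<open>auto simp: linear_mod_def[of _ _ "\<lambda>x. 0"] free.subspace_0 intro!: linear_mod_add\<close>)

lemma linear_mod_comp:
  assumes "linear_mod s N h" "Vector_Spaces.linear s s f"
  shows "linear_mod s N (\<lambda>x. h (f x))"
  using assms by (simp add: linear_mod_def Vector_Spaces.linear_iff)

lemma slot_relators_subset_imp:
  assumes "slot_relators s \<phi> \<subseteq> N" shows "linear_mod s N (\<lambda>x. pure (\<phi> x))"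
  using assms unfolding linear_mod_def slot_relators_def by blast

lemma linear_mod_pure2:
  "linear_mod s (relations2 s) (\<lambda>x. pure (x, y))"
  "linear_mod s (relations2 s) (\<lambda>y. pure (x, y))"
proof -
  let ?S = "(\<Union>y. slot_relators s (\<lambda>x. (x, y))) \<union> (\<Union>x. slot_relators s (\<lambda>y. (x, y)))"
  have *: "linear_mod s (relations2 s) (\<lambda>x. pure (\<phi> x))" if "slot_relators s \<phi> \<subseteq> ?S" for \<phi>
    unfolding relations2_def
    by (rule slot_relators_subset_imp[OF order_trans[OF that free.span_superset]])
  show "linear_mod s (relations2 s) (\<lambda>x. pure (x, y))"
    by (rule *, rule subsetI, rule UnI1) (rule UN_I[OF UNIV_I])
  show "linear_mod s (relations2 s) (\<lambda>y. pure (x, y))"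
    by (rule *, rule subsetI, rule UnI2) (rule UN_I[OF UNIV_I])
qed

lemma linear_mod_pure3:
  "linear_mod s (relations3 s) (\<lambda>x. pure (x, y, z))"
  "linear_mod s (relations3 s) (\<lambda>y. pure (x, y, z))"
  "linear_mod s (relations3 s) (\<lambda>z. pure (x, y, z))"
proof -
  let ?S = "(\<Union>y z. slot_relators s (\<lambda>x. (x, y, z))) \<union> (\<Union>x z. slot_relators s (\<lambda>y. (x, y, z)))
    \<union> (\<Union>x y. slot_relators s (\<lambda>z. (x, y, z)))"
  have *: "linear_mod s (relations3 s) (\<lambda>x. pure (\<phi> x))" if "slot_relators s \<phi> \<subseteq> ?S" for \<phi>
    unfolding relations3_def
    by (rule slot_relators_subset_imp[OF order_trans[OF that free.span_superset]])
  show "linear_mod s (relations3 s) (\<lambda>x. pure (x, y, z))"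
    by (rule *, rule subsetI, rule UnI1, rule UnI1) (rule UN_I[OF UNIV_I], rule UN_I[OF UNIV_I])
  show "linear_mod s (relations3 s) (\<lambda>y. pure (x, y, z))"
    by (rule *, rule subsetI, rule UnI1, rule UnI2) (rule UN_I[OF UNIV_I], rule UN_I[OF UNIV_I])
  show "linear_mod s (relations3 s) (\<lambda>z. pure (x, y, z))"
    by (rule *, rule subsetI, rule UnI2) (rule UN_I[OF UNIV_I], rule UN_I[OF UNIV_I])
qed

definition lin_ext :: "('b \<Rightarrow> ('c \<Rightarrow>\<^sub>0 'k)) \<Rightarrow> ('b \<Rightarrow>\<^sub>0 'k::field) \<Rightarrow> ('c \<Rightarrow>\<^sub>0 'k)" where
  "lin_ext b f = (\<Sum>p\<in>Poly_Mapping.keys f. fscale (Poly_Mapping.lookup f p) (b p))"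

lemma lin_ext_superset:
  assumes "finite P" "Poly_Mapping.keys f \<subseteq> P"
  shows "lin_ext b f = (\<Sum>p\<in>P. fscale (Poly_Mapping.lookup f p) (b p))"
  unfolding lin_ext_def using assms
  by (intro sum.mono_neutral_left) (auto simp: in_keys_iff)

lemma lin_ext_add: "lin_ext b (f + g) = lin_ext b f + lin_ext b g"
  using keys_add[of f g]
  by (simp add: lin_ext_superset[of "Poly_Mapping.keys f \<union> Poly_Mapping.keys g"] lookup_add free.scale_left_distrib
      sum.distrib)

lemma lin_ext_scale: "lin_ext b (fscale c f) = fscale c (lin_ext b f)"
proof -
  have "Poly_Mapping.keys (fscale c f) \<subseteq> Poly_Mapping.keys f" by (auto simp: in_keys_iff)
  from lin_ext_superset[OF finite_keys this] show ?thesis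
    by (simp add: lin_ext_def[of b f] free.scale_sum_right)
qed

lemma lin_ext_diff: "lin_ext b (f - g) = lin_ext b f - lin_ext b g"
  using lin_ext_add[of b "f - g" g] by simp

lemma lin_ext_zero [simp]: "lin_ext b 0 = 0"
  by (simp add: lin_ext_def)

lemma lin_ext_pure [simp]: "lin_ext b (pure p) = b p"
  by (simp add: lin_ext_def)

lemma lin_ext_sum: "lin_ext b (\<Sum>i\<in>I. f i) = (\<Sum>i\<in>I. lin_ext b (f i))"
  by (induction I rule: infinite_finite_induct) (simp_all add: lin_ext_add)

lemma lin_ext_diff_left: "lin_ext (\<lambda>p. b p - c p) f = lin_ext b f - lin_ext c f"
  by (simp add: lin_ext_def free.scale_right_diff_distrib sum_subtractf)

lemma lin_ext_in_subspace:
  assumes "free.subspace N" "\<And>p. b p \<in> N" shows "lin_ext b f \<in> N"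
  unfolding lin_ext_def
  by (intro free.subspace_sum free.subspace_scale assms)

lemma lin_ext_pure_id: "lin_ext pure f = f"
  unfolding lin_ext_def
  by (intro poly_mapping_eqI)
    (auto simp: lookup_sum lookup_single when_def in_keys_iff if_distrib cong: if_cong)

lemma lin_ext_relations2:
  assumes N: "free.subspace N"
    and "\<And>y. linear_mod s N (\<lambda>x. b (x, y))" "\<And>x. linear_mod s N (\<lambda>y. b (x, y))"
    and f: "f \<in> relations2 s"
  shows "lin_ext b f \<in> N"
  using f unfolding relations2_def
proof (induction rule: free.span_induct_alt)
  case base
  then show ?case using N by (simp add: free.subspace_0)
next
  case (step c x y)
  have "lin_ext b x \<in> N"
    using step(1) assms(2,3)
    by (auto simp: slot_relators_def linear_mod_def lin_ext_diff lin_ext_scale)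
  with step(2) show ?case
    by (simp add: lin_ext_add lin_ext_scale N free.subspace_add free.subspace_scale)
qed

lemma presentation_independent:
  fixes T :: "'a::ab_group_add \<times> 'a \<Rightarrow> 'a \<times> 'a \<Rightarrow> ('c \<Rightarrow>\<^sub>0 'k::field)"
  assumes N: "free.subspace N"
    and T1: "\<And>y q. linear_mod s N (\<lambda>x. T (x, y) q)" "\<And>x q. linear_mod s N (\<lambda>y. T (x, y) q)"
    and T2: "\<And>p y. linear_mod s N (\<lambda>x. T p (x, y))" "\<And>p x. linear_mod s N (\<lambda>y. T p (x, y))"
    and eq: "tensor_sum s n u v = tensor_sum s n' u' v'"
  shows "(\<Sum>i<n. \<Sum>j<n. T (u i, v i) (u j, v j))
           - (\<Sum>i<n'. \<Sum>j<n'. T (u' i, v' i) (u' j, v' j)) \<in> N"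
proof -
  define f :: "'a \<times> 'a \<Rightarrow>\<^sub>0 'k" where "f = (\<Sum>i<n. pure (u i, v i))"
  define g :: "'a \<times> 'a \<Rightarrow>\<^sub>0 'k" where "g = (\<Sum>i<n'. pure (u' i, v' i))"
  have d: "f - g \<in> relations2 s"
    using eq by (simp add: tensor_sum_def f_def g_def coset_eq_iff)
  let ?E = "\<lambda>h. lin_ext (\<lambda>p. lin_ext (T p) h)"
  have "?E f f = (\<Sum>i<n. \<Sum>j<n. T (u i, v i) (u j, v j))"
    by (simp add: f_def lin_ext_sum)
  moreover have "?E g g = (\<Sum>i<n'. \<Sum>j<n'. T (u' i, v' i) (u' j, v' j))"
    by (simp add: g_def lin_ext_sum)
  moreover have "?E f f - ?E g g = ?E (f - g) f + ?E g (f - g)"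
    by (simp add: lin_ext_diff lin_ext_diff_left)
  moreover have "?E (f - g) f + ?E g (f - g) \<in> N"
  proof (rule free.subspace_add[OF N])
    show "?E (f - g) f \<in> N"
      by (intro lin_ext_in_subspace[OF N] lin_ext_relations2[OF N _ _ d] T2)
    show "?E g (f - g) \<in> N"
      using T1
      by (intro lin_ext_relations2[OF N _ _ d])
        (auto simp: lin_ext_def intro!: linear_mod_sum linear_mod_scale N)
  qed
  ultimately show ?thesis by (simp only:)
qed

lemma tensor_square_eq_tensor_sum:
  assumes "vector_space s" "r \<in> tensor_square s"
  obtains n u v where "r = tensor_sum s n u v"
proof -
  from assms(2) obtain f where r: "r = coset (relations2 s) f"
    by (auto simp: tensor_square_def)
  obtain e where e: "bij_betw e {..<card (Poly_Mapping.keys f)} (Poly_Mapping.keys f)"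
    using ex_bij_betw_nat_finite[OF finite_keys] by (auto simp: lessThan_atLeast0)
  let ?u = "\<lambda>i. s (Poly_Mapping.lookup f (e i)) (fst (e i))" and ?v = "\<lambda>i. snd (e i)"
  have *: "pure (s c x, y) - fscale c (pure (x, y)) \<in> relations2 s" for c x y
    using linear_mod_pure2(1) unfolding linear_mod_def by blast
  have "f = (\<Sum>p\<in>Poly_Mapping.keys f. fscale (Poly_Mapping.lookup f p) (pure p))"
    using lin_ext_pure_id[of f] by (simp add: lin_ext_def)
  also have "\<dots> = (\<Sum>i<card (Poly_Mapping.keys f). fscale (Poly_Mapping.lookup f (e i)) (pure (e i)))"
    by (rule sum.reindex_bij_betw[OF e, symmetric])
  finally have "(\<Sum>i<card (Poly_Mapping.keys f). pure (?u i, ?v i)) - f =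
      (\<Sum>i<card (Poly_Mapping.keys f). pure (?u i, ?v i) - fscale (Poly_Mapping.lookup f (e i)) (pure (e i)))"
    by (simp add: sum_subtractf)
  also have "\<dots> \<in> relations2 s"
  proof (intro free.subspace_sum subspace_relations)
    fix i show "pure (?u i, ?v i) - fscale (Poly_Mapping.lookup f (e i)) (pure (e i)) \<in> relations2 s"
      using *[of "Poly_Mapping.lookup f (e i)" "fst (e i)" "snd (e i)"] by simp
  qed
  finally have "tensor_sum s (card (Poly_Mapping.keys f)) ?u ?v = r"
    by (simp add: r tensor_sum_def coset_eq_iff)
  then show ?thesis by (rule that[OF sym])
qed

lemma twist_tensor_sum: "twist (tensor_sum s n u v) = tensor_sum s n v u"
proof -
  let ?t = "Poly_Mapping.map_key prod.swap :: ('a \<times> 'a \<Rightarrow>\<^sub>0 'b) \<Rightarrow> _"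
  have add: "?t (f + g) = ?t f + ?t g" for f g by (simp add: map_key_plus)
  have lookup_t: "Poly_Mapping.lookup (?t f) p = Poly_Mapping.lookup f (prod.swap p)" for f p
    by (simp add: map_key.rep_eq)
  have tt: "?t (?t f) = f" for f
    by (intro poly_mapping_eqI) (simp add: lookup_t)
  have zero: "?t 0 = 0"
    by (intro poly_mapping_eqI) (simp add: lookup_t)
  have scale: "?t (fscale c f) = fscale c (?t f)" for c f
    by (intro poly_mapping_eqI) (simp add: lookup_t)
  have diff: "?t (f - g) = ?t f - ?t g" for f g
    by (intro poly_mapping_eqI) (simp add: lookup_t lookup_minus)
  have pure_swap: "?t (pure p) = pure (prod.swap p)" for p
    using map_key_single[of prod.swap "prod.swap p" "1 :: 'b"] by simp
  have t_sum: "?t (\<Sum>i\<in>I. h i) = (\<Sum>i\<in>I. ?t (h i))" for h :: "'c \<Rightarrow> _" and I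
    by (intro poly_mapping_eqI) (simp add: lookup_t lookup_sum)
  have sum: "?t (\<Sum>i<n. pure (u i, v i)) = (\<Sum>i<n. pure (v i, u i))"
    by (induction n) (simp_all add: add pure_swap zero)
  have ext: "?t f = lin_ext (\<lambda>p. pure (prod.swap p)) f" for f
  proof -
    have "lin_ext (\<lambda>p. pure (prod.swap p)) f = ?t (lin_ext pure f)"
      by (simp add: lin_ext_def t_sum scale pure_swap)
    then show ?thesis by (simp add: lin_ext_pure_id)
  qed
  have rel: "?t f \<in> relations2 s" if "f \<in> relations2 s" for f
    unfolding ext
    by (rule lin_ext_relations2[OF _ _ _ that]) (simp_all add: linear_mod_pure2)
  have "?t ` coset (relations2 s) f = coset (relations2 s) (?t f)" for f
  proof (intro equalityI subsetI)
    fix g assume "g \<in> ?t ` coset (relations2 s) f"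
    then show "g \<in> coset (relations2 s) (?t f)"
      using rel by (auto simp: coset_def simp flip: diff)
  next
    fix g assume "g \<in> coset (relations2 s) (?t f)"
    then have "?t g \<in> coset (relations2 s) f"
      using rel[of "g - ?t f"] by (simp add: coset_def diff tt)
    then show "g \<in> ?t ` coset (relations2 s) f"
      using tt by (metis image_eqI)
  qed
  then show ?thesis
    by (simp add: twist_def tensor_sum_def sum)
qed

lemma assoc_yb_tensor_sum:
  assumes "bilinear_map s mu" "Vector_Spaces.linear s s alpha"
  shows "assoc_yb s mu alpha (tensor_sum s n u v) =
           coset (relations3 s) (assoc_yb_rep mu alpha n u v)"
proof -
  let ?T = "\<lambda>(x, y) (x', y'). pure (mu x x', alpha y', alpha y)
      - pure (alpha x, mu y x', alpha y') + pure (alpha x', alpha x, mu y y')"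
  have T: "assoc_yb_rep mu alpha n u v = (\<Sum>i<n. \<Sum>j<n. ?T (u i, v i) (u j, v j))" for n u v
    by (simp add: assoc_yb_rep_def sum.distrib sum_subtractf)
  have lin: "Vector_Spaces.linear s s (mu x)" "Vector_Spaces.linear s s (\<lambda>x. mu x y)" for x y
    using assms by (simp_all add: bilinear_map_def)
  note comp = linear_mod_pure3[THEN linear_mod_comp, OF lin(1)]
    linear_mod_pure3[THEN linear_mod_comp, OF lin(2)]
    linear_mod_pure3[THEN linear_mod_comp, OF assms(2)]
  show ?thesis unfolding assoc_yb_def
  proof (rule the_equality, blast, elim exE conjE)
    fix t n' u' v'
    assume eq: "tensor_sum s n u v = tensor_sum s n' u' v'"
      and t: "t = coset (relations3 s) (assoc_yb_rep mu alpha n' u' v')"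
    have "assoc_yb_rep mu alpha n' u' v' - assoc_yb_rep mu alpha n u v \<in> relations3 s"
      unfolding T
      by (rule presentation_independent[OF _ _ _ _ _ eq[symmetric]])
        (auto split: prod.splits intro!: linear_mod_add linear_mod_diff comp)
    then show "t = coset (relations3 s) (assoc_yb_rep mu alpha n u v)"
      by (simp add: t coset_eq_iff)
  qed
qed

lemma classical_yb_tensor_sum:
  assumes "bilinear_map s bracket" "Vector_Spaces.linear s s alpha"
  shows "classical_yb s bracket alpha (tensor_sum s n u v) =
           coset (relations3 s) (classical_yb_rep bracket alpha n u v)"
proof -
  let ?T = "\<lambda>(x, y) (x', y'). pure (bracket x x', alpha y, alpha y')
      + pure (alpha x, bracket y x', alpha y') + pure (alpha x, alpha x', bracket y y')"
  have T: "classical_yb_rep bracket alpha n u v =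
      (\<Sum>i<n. \<Sum>j<n. ?T (u i, v i) (u j, v j))" for n u v
    by (simp add: classical_yb_rep_def sum.distrib)
  have lin: "Vector_Spaces.linear s s (bracket x)"
    "Vector_Spaces.linear s s (\<lambda>x. bracket x y)" for x y
    using assms by (simp_all add: bilinear_map_def)
  note comp = linear_mod_pure3[THEN linear_mod_comp, OF lin(1)]
    linear_mod_pure3[THEN linear_mod_comp, OF lin(2)]
    linear_mod_pure3[THEN linear_mod_comp, OF assms(2)]
  show ?thesis unfolding classical_yb_def
  proof (rule the_equality, blast, elim exE conjE)
    fix t n' u' v'
    assume eq: "tensor_sum s n u v = tensor_sum s n' u' v'"
      and t: "t = coset (relations3 s) (classical_yb_rep bracket alpha n' u' v')"
    have "classical_yb_rep bracket alpha n' u' v' - classical_yb_rep bracket alpha n u v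
        \<in> relations3 s"
      unfolding T
      by (rule presentation_independent[OF _ _ _ _ _ eq[symmetric]])
        (auto split: prod.splits intro!: linear_mod_add linear_mod_diff comp)
    then show "t = coset (relations3 s) (classical_yb_rep bracket alpha n u v)"
      by (simp add: t coset_eq_iff)
  qed
qed

end

theory Submission
  imports Defs
begin

text \<open>
  Expanding the commutators in \<open>C(r)\<close> gives six sums. Three of them form \<open>- A(r)\<close>; the other three
  are obtained from \<open>A(\<tau>(r))\<close> by reversing the order of the three tensor factors. As \<open>A\<close> is
  quadratic, \<open>A(\<tau>(r)) = A(\<plusminus> r) = A(r) = 0\<close>.
\<close>

text \<open>This is homogeneity modulo \<open>N\<close> for the scalar \<open>- 1\<close>:
  \<open>h (- x)\<close> is congruent to \<open>- h x\<close>.\<close>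

lemma linear_mod_neg:
  assumes h: "linear_mod s N h" and s: "vector_space s"
  shows "h x + h (- x) \<in> N"
proof -
  interpret vector_space s by fact
  have "h (s (- 1) x) - fscale (- 1) (h x) \<in> N"
    using h unfolding linear_mod_def by blast
  then show ?thesis by (simp add: add.commute)
qed

lemma linear_mod_minus:
  assumes N: "free.subspace N" and h: "linear_mod s N h"
  shows "h (x - y) - (h x - h y) \<in> N"
proof -
  have "h ((x - y) + y) - h (x - y) - h y \<in> N"
    using h unfolding linear_mod_def by blast
  from free.subspace_neg[OF N this] show ?thesis by (simp add: algebra_simps)
qed

text \<open>The universal property of the tensor cube: a map linear in each slot modulo
  \<open>N\<close> sends every generating relator into \<open>N\<close>, and \<open>lin_ext\<close>
  carries this over to their span.\<close>

lemma lin_ext_relations3: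
  assumes N: "free.subspace N"
    and "\<And>y z. linear_mod s N (\<lambda>x. b (x, y, z))" "\<And>x z. linear_mod s N (\<lambda>y. b (x, y, z))"
      "\<And>x y. linear_mod s N (\<lambda>z. b (x, y, z))"
    and f: "f \<in> relations3 s"
  shows "lin_ext b f \<in> N"
  using f unfolding relations3_def
proof (induction rule: free.span_induct_alt)
  case base
  then show ?case using N by (simp add: free.subspace_0)
next
  case (step c x y)
  have "lin_ext b x \<in> N"
    using step(1) assms(2-4)
    by (auto simp: slot_relators_def linear_mod_def lin_ext_diff lin_ext_scale)
  with step(2) show ?case
    by (simp add: lin_ext_add lin_ext_scale N free.subspace_add free.subspace_scale)
qed

text \<open>Reversing the factors keeps linearity in each slot, so it descends to the tensor
  cube.\<close>

lemma lin_ext_reverse_relations3: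
  assumes "f \<in> relations3 s"
  shows "lin_ext (\<lambda>(x, y, z). pure (z, y, x)) f \<in> relations3 s"
  by (rule lin_ext_relations3[OF _ _ _ _ assms]) (simp_all add: linear_mod_pure3)

lemma pure_neg_neg_relations3:
  fixes s :: "'k::field \<Rightarrow> 'a::ab_group_add \<Rightarrow> 'a"
  assumes s: "vector_space s"
  shows "pure (- x, - y, z) - pure (x, y, z) \<in> relations3 s"
    and "pure (x, - y, - z) - pure (x, y, z) \<in> relations3 s"
    and "pure (- x, y, - z) - pure (x, y, z) \<in> relations3 s"
proof -
  note neg = linear_mod_neg[OF linear_mod_pure3(1) s]
    linear_mod_neg[OF linear_mod_pure3(2) s]
    linear_mod_neg[OF linear_mod_pure3(3) s]
  \<comment> \<open>Here \<open>b\<close> is the intermediate pure tensor in which only one of the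
    two signs is changed; each single change negates modulo relations.\<close>
  have cancel: "a - c \<in> relations3 s"
    if "b + a \<in> relations3 s" "c + b \<in> relations3 s" for a b c :: "'a \<times> 'a \<times> 'a \<Rightarrow>\<^sub>0 'k"
    using free.subspace_diff[OF subspace_relations(2) that] by (simp add: add.commute[of c b])
  show "pure (- x, - y, z) - pure (x, y, z) \<in> relations3 s"
    by (rule cancel[OF neg(1) neg(2)])
  show "pure (x, - y, - z) - pure (x, y, z) \<in> relations3 s"
    by (rule cancel[OF neg(2) neg(3)])
  show "pure (- x, y, - z) - pure (x, y, z) \<in> relations3 s"
    by (rule cancel[OF neg(1) neg(3)])
qed

text \<open>Absorbing the sign into the first factors gives the negated tensor an explicit
  presentation of the same length, to which the formula for \<open>assoc_yb\<close> applies.\<close>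

lemma uminus_tensor_sum:
  fixes s :: "'k::field \<Rightarrow> 'a::ab_group_add \<Rightarrow> 'a"
  assumes s: "vector_space s"
  shows "uminus ` tensor_sum s n u v = tensor_sum s n (\<lambda>i. - u i) v"
proof -
  have "(\<Sum>i<n. pure (u i, v i) + pure (- u i, v i)) \<in> relations2 s"
    by (intro free.subspace_sum subspace_relations linear_mod_neg[OF linear_mod_pure2(1) s])
  from free.subspace_neg[OF subspace_relations(1) this]
  have d: "- (\<Sum>i<n. pure (u i, v i)) - (\<Sum>i<n. pure (- u i, v i)) \<in> relations2 s"
    by (simp add: sum.distrib)
  have neg: "- f \<in> relations2 s \<longleftrightarrow> f \<in> relations2 s" for f :: "'a \<times> 'a \<Rightarrow>\<^sub>0 'k"
    using free.subspace_neg[OF subspace_relations(1), of f]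
      free.subspace_neg[OF subspace_relations(1), of "- f"]
    by auto
  have "uminus ` coset (relations2 s) f = coset (relations2 s) (- f)" for f
  proof (intro equalityI subsetI)
    fix g assume "g \<in> uminus ` coset (relations2 s) f"
    then obtain h where "g = - h" "h - f \<in> relations2 s" by (auto simp: coset_def)
    then show "g \<in> coset (relations2 s) (- f)"
      using neg[of "h - f"] by (simp add: coset_def)
  next
    fix g assume "g \<in> coset (relations2 s) (- f)"
    moreover have "- (- g - f) = g - - f" by simp
    ultimately have "- g \<in> coset (relations2 s) f"
      using neg[of "- g - f"] unfolding coset_def by (metis mem_Collect_eq)
    then show "g \<in> uminus ` coset (relations2 s) f"
      by (metis image_eqI minus_minus)
  qed
  then have "uminus ` tensor_sum s n u v = coset (relations2 s) (- (\<Sum>i<n. pure (u i, v i)))"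
    by (simp add: tensor_sum_def)
  also have "\<dots> = tensor_sum s n (\<lambda>i. - u i) v"
    using d by (simp add: tensor_sum_def coset_eq_iff)
  finally show ?thesis .
qed

context hom_associative_algebra
begin

lemma minus_left: "mu (- x) y = - mu x y" and minus_right: "mu x (- y) = - mu x y"
  and alpha_minus: "alpha (- x) = - alpha x"
proof -
  have "mu (scale (- 1) x) y = scale (- 1) (mu x y)" "mu x (scale (- 1) y) = scale (- 1) (mu x y)"
    "alpha (scale (- 1) x) = scale (- 1) (alpha x)"
    using mu_bilinear alpha_linear unfolding bilinear_map_iff Vector_Spaces.linear_iff by blast+
  then show "mu (- x) y = - mu x y" "mu x (- y) = - mu x y" "alpha (- x) = - alpha x"
    by simp_all
qed

text \<open>Every term involves two of the \<open>u i\<close>, so two signs appear and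
  cancel.\<close>

lemma assoc_yb_rep_uminus:
  "assoc_yb_rep mu alpha n (\<lambda>i. - u i) v - assoc_yb_rep mu alpha n u v \<in> relations3 scale"
proof -
  \<comment> \<open>In the first sum of \<open>assoc_yb_rep\<close> both signs sit inside one
    \<open>mu\<close> and cancel exactly. In the other two they sit in slots 1 and 2 and cancel only
    modulo relations.\<close>
  have "(\<Sum>i<n. \<Sum>j<n.
        (pure (alpha (- u j), alpha (- u i), mu (v i) (v j))
          - pure (alpha (u j), alpha (u i), mu (v i) (v j)))
        - (pure (alpha (- u i), mu (v i) (- u j), alpha (v j))
          - pure (alpha (u i), mu (v i) (u j), alpha (v j)))) \<in> relations3 scale"
    unfolding minus_right alpha_minus
    by (intro free.subspace_sum free.subspace_diff subspace_relations
        pure_neg_neg_relations3 vector_space_axioms)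
  then show ?thesis
    by (simp add: assoc_yb_rep_def minus_left minus_right sum_subtractf sum.distrib algebra_simps)
qed

lemma classical_yb_rep_commutator:
  "classical_yb_rep (commutator mu) alpha n u v
     - (lin_ext (\<lambda>(x, y, z). pure (z, y, x)) (assoc_yb_rep mu alpha n v u)
        - assoc_yb_rep mu alpha n u v) \<in> relations3 scale"
proof -
  note minus = linear_mod_pure3[THEN linear_mod_minus[OF subspace_relations(2)]]
  \<comment> \<open>The congruence is not an equality only because a commutator is split inside a
    slot; \<open>?d1\<close>, \<open>?d2\<close> and \<open>?d3\<close> are the errors of this
    splitting in slots 1, 2 and 3.\<close>
  let ?d1 = "\<lambda>i j. pure (mu (u i) (u j) - mu (u j) (u i), alpha (v i), alpha (v j))
    - (pure (mu (u i) (u j), alpha (v i), alpha (v j)) - pure (mu (u j) (u i), alpha (v i), alpha (v j)))"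
  let ?d2 = "\<lambda>i j. pure (alpha (u i), mu (v i) (u j) - mu (u j) (v i), alpha (v j))
    - (pure (alpha (u i), mu (v i) (u j), alpha (v j)) - pure (alpha (u i), mu (u j) (v i), alpha (v j)))"
  let ?d3 = "\<lambda>i j. pure (alpha (u i), alpha (u j), mu (v i) (v j) - mu (v j) (v i))
    - (pure (alpha (u i), alpha (u j), mu (v i) (v j)) - pure (alpha (u i), alpha (u j), mu (v j) (v i)))"
  have d: "(\<Sum>i<n. \<Sum>j<n. ?d1 i j) + (\<Sum>i<n. \<Sum>j<n. ?d2 i j) + (\<Sum>i<n. \<Sum>j<n. ?d3 i j)
      \<in> relations3 scale"
    by (intro free.subspace_sum free.subspace_add subspace_relations minus)
  \<comment> \<open>Exchanging \<open>i\<close> and \<open>j\<close> gives the index pattern of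
    \<open>assoc_yb_rep\<close>: the first and third sums then occur in the part for
    \<open>u v\<close>, the second in the reversed part for \<open>v u\<close>.\<close>
  have swap: "(\<Sum>i<n. \<Sum>j<n. pure (mu (u j) (u i), alpha (v i), alpha (v j))) =
      (\<Sum>i<n. \<Sum>j<n. pure (mu (u i) (u j), alpha (v j), alpha (v i)))"
    "(\<Sum>i<n. \<Sum>j<n. pure (alpha (u i), mu (u j) (v i), alpha (v j))) =
      (\<Sum>i<n. \<Sum>j<n. pure (alpha (u j), mu (u i) (v j), alpha (v i)))"
    "(\<Sum>i<n. \<Sum>j<n. pure (alpha (u i), alpha (u j), mu (v j) (v i))) =
      (\<Sum>i<n. \<Sum>j<n. pure (alpha (u j), alpha (u i), mu (v i) (v j)))"
    by (rule sum.swap)+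
  show ?thesis
    using d
    by (simp add: classical_yb_rep_def assoc_yb_rep_def commutator_def lin_ext_add lin_ext_diff
        lin_ext_sum sum_subtractf sum.distrib swap algebra_simps)
qed

end

theorem theorem7p2:
  fixes scale :: "'k::field_char_0 \<Rightarrow> 'a::ab_group_add \<Rightarrow> 'a"
    and mu :: "'a \<Rightarrow> 'a \<Rightarrow> 'a"
    and alpha :: "'a \<Rightarrow> 'a"
    and r :: "('a \<times> 'a \<Rightarrow>\<^sub>0 'k) set"
  assumes "hom_associative_algebra scale mu alpha"
    and "r \<in> tensor_square scale"
    and "AHYBE_solution scale mu alpha r"
    and "symmetric_tensor r \<or> antisymmetric_tensor r"
  shows "CHYBE_solution scale (commutator mu) alpha r"
proof -
  interpret hom_associative_algebra scale mu alpha by fact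
  note N = subspace_relations(2)[of scale]
  obtain n u v where r: "r = tensor_sum scale n u v"
    using tensor_square_eq_tensor_sum[OF vector_space_axioms assms(2)] .
  \<comment> \<open>Keeping the presentation arbitrary allows \<open>r\<close> to be presented by
    \<open>u v\<close> and also by \<open>v u\<close> or its negation.\<close>
  have A: "assoc_yb_rep mu alpha n u' v' \<in> relations3 scale"
    if "r = tensor_sum scale n u' v'" for u' v'
    using assms(3) unfolding that
    by (simp add: AHYBE_solution_def assoc_yb_tensor_sum[OF mu_bilinear alpha_linear]
        zero_cube_def coset_eq_iff)
  have "assoc_yb_rep mu alpha n v u \<in> relations3 scale"
    using assms(4)
  proof
    assume "symmetric_tensor r"
    then have "r = tensor_sum scale n v u"
      by (simp add: r symmetric_tensor_def twist_tensor_sum)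
    then show ?thesis by (rule A)
  next
    assume "antisymmetric_tensor r"
    then have "tensor_sum scale n v u = uminus ` r"
      by (simp add: r antisymmetric_tensor_def twist_tensor_sum)
    then have "r = uminus ` tensor_sum scale n v u"
      by (simp add: image_image)
    \<comment> \<open>Now \<open>A\<close> applies to this presentation, and
      \<open>assoc_yb_rep_uminus\<close> removes the sign from \<open>v\<close>.\<close>
    then have "r = tensor_sum scale n (\<lambda>i. - v i) u"
      by (simp add: uminus_tensor_sum[OF vector_space_axioms])
    from free.subspace_diff[OF N A[OF this] assoc_yb_rep_uminus[of n v u]]
    show ?thesis by simp
  qed
  \<comment> \<open>Both the reversed expression for \<open>v u\<close> and the expression for
    \<open>u v\<close> are relations, hence so is their difference, to which \<open>C(r)\<close> is
    congruent.\<close>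
  from free.subspace_add[OF N classical_yb_rep_commutator[of n u v]
      free.subspace_diff[OF N lin_ext_reverse_relations3[OF this] A[OF r]]]
  have "classical_yb_rep (commutator mu) alpha n u v \<in> relations3 scale"
    by simp
  then show ?thesis
    using assms(2) unfolding CHYBE_solution_def r
    by (simp add: classical_yb_tensor_sum[OF bilinear_map_commutator[OF mu_bilinear] alpha_linear]
        zero_cube_def coset_eq_iff)
qed

end
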